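(* The family of Steiner-Soddy polygons $P$ is Ponceletian: there are a fixed conic $E$ and a fixed circle $C$ such that every polygon $P$ of the family is inscribed in $E$ (all its vertices lie on $E$) and circumscribes $C$ (all its side lines are tangent to $C$).
   Context: Setting. Let $N\ge 3$, $R>0$, $\alpha=\pi/N$. For $\varphi\in\mathbb{R}$ consider the $N$ circles of radius $R\sin\alpha$ centered at the vertices $R(\cos(\varphi+2\pi i/N),\sin(\varphi+2\pi i/N))$, $i=1,\dots,N$ (indices mod $N$), of a regular $N$-gon. Consecutive circles are tangent; all are tangent to the two circles centered at the origin with radii $R(1-\sin\alpha)$ and $R(1+\sin\alpha)$; the points of contact of consecutive circles lie on the circle $C_{reg}$ centered at the origin with radius $R\cos\alpha$. Fix an inversion circle with center $Q$ and radius $\lambda>0$, where $Q\notin C_{reg}$. The images under this inversion of the $N$ circles form a Steiner chain; letting $\varphi$ vary (with $R,Q,\lambda$ fixed) gives the Steiner porism. Values of $\varphi$ for which $Q$ lies on one of the $N$ circles are excluded, so all circles of the chain are genuine circles. The circle $C$ is the inversive image of $C_{reg}$. The Steiner-Soddy polygon $P$ (for given $\varphi$) is the $N$-gon whose consecutive vertices are the centers of the consecutive circles in the Steiner chain; the Steiner-Soddy family consists of these polygons as $\varphi$ varies. *)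

theory Defs
  imports "HOL-Analysis.Analysis"
begin

text \<open>The Euclidean plane is the type \<^typ>\<open>complex\<close>; circles are the sets \<^term>\<open>sphere c r\<close>
  with positive radius. The polygon and chain lists below are indexed cyclically.\<close>

definition is_circle :: "complex set \<Rightarrow> bool" where
  "is_circle S \<longleftrightarrow> (\<exists>c r. r > 0 \<and> S = sphere c r)"

definition circle_center :: "complex set \<Rightarrow> complex" where
  "circle_center S = (THE c. \<exists>r>0. S = sphere c r)"

definition is_line :: "complex set \<Rightarrow> bool" where
  "is_line L \<longleftrightarrow> affine L \<and> aff_dim L = 1"

definition tangent_line :: "complex set \<Rightarrow> complex set \<Rightarrow> bool" where
  "tangent_line L C \<longleftrightarrow> is_line L \<and> is_circle C \<and> (\<exists>!p. p \<in> L \<inter> C)"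

text \<open>A conic is non-degenerate (the determinant excludes line pairs, double lines and
  polynomials of degree below two) and has at least one real point.\<close>

definition is_conic :: "complex set \<Rightarrow> bool" where
  "is_conic E \<longleftrightarrow> E \<noteq> {} \<and> (\<exists>a b c d e f :: real.
     E = {z. a * (Re z)\<^sup>2 + 2 * b * Re z * Im z + c * (Im z)\<^sup>2
             + 2 * d * Re z + 2 * e * Im z + f = 0} \<and>
     det (vector [vector [a, b, d], vector [b, c, e], vector [d, e, f]] :: real ^ 3 ^ 3) \<noteq> 0)"

text \<open>Only points other than the center \<^term>\<open>Q\<close> are meaningful arguments.\<close>

definition inversion :: "complex \<Rightarrow> real \<Rightarrow> complex \<Rightarrow> complex" where
  "inversion Q l z = Q + (l\<^sup>2 / (dist z Q)\<^sup>2) *\<^sub>R (z - Q)"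

definition ring_circle :: "nat \<Rightarrow> real \<Rightarrow> real \<Rightarrow> nat \<Rightarrow> complex set" where
  "ring_circle N R \<phi> i = sphere (rcis R (\<phi> + 2 * pi * real i / real N)) (R * sin (pi / real N))"

definition C_reg :: "nat \<Rightarrow> real \<Rightarrow> complex set" where
  "C_reg N R = sphere 0 (R * cos (pi / real N))"

definition admissible :: "nat \<Rightarrow> real \<Rightarrow> complex \<Rightarrow> real \<Rightarrow> bool" where
  "admissible N R Q \<phi> \<longleftrightarrow> (\<forall>i\<in>{1..N}. Q \<notin> ring_circle N R \<phi> i)"

definition steiner_chain ::
    "nat \<Rightarrow> real \<Rightarrow> complex \<Rightarrow> real \<Rightarrow> real \<Rightarrow> complex set list" where
  "steiner_chain N R Q l \<phi> = map (\<lambda>i. inversion Q l ` ring_circle N R \<phi> i) [1..<Suc N]"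

definition steiner_soddy_polygon ::
    "nat \<Rightarrow> real \<Rightarrow> complex \<Rightarrow> real \<Rightarrow> real \<Rightarrow> complex list" where
  "steiner_soddy_polygon N R Q l \<phi> = map circle_center (steiner_chain N R Q l \<phi>)"

definition steiner_soddy_family ::
    "nat \<Rightarrow> real \<Rightarrow> complex \<Rightarrow> real \<Rightarrow> complex list set" where
  "steiner_soddy_family N R Q l = {steiner_soddy_polygon N R Q l \<phi> | \<phi>. admissible N R Q \<phi>}"

definition inscribed_in :: "complex list \<Rightarrow> complex set \<Rightarrow> bool" where
  "inscribed_in P E \<longleftrightarrow> set P \<subseteq> E"

definition side_line :: "complex list \<Rightarrow> nat \<Rightarrow> complex set" where
  "side_line P i = affine hull {P ! i, P ! (Suc i mod length P)}"

text \<open>Tangency includes that each \<^term>\<open>side_line P i\<close> is a genuine line, i.e. that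
  consecutive vertices are distinct.\<close>

definition circumscribes :: "complex list \<Rightarrow> complex set \<Rightarrow> bool" where
  "circumscribes P C \<longleftrightarrow> (\<forall>i<length P. tangent_line (side_line P i) C)"

text \<open>The definite description in \<^const>\<open>circle_center\<close> is well defined, and the members
  of the chain are circles.\<close>

lemma circle_center_sphere:
  assumes "r > 0"
  shows "circle_center (sphere c r) = c"
proof -
  have "c' = c" if "s > 0" "sphere c r = sphere c' s" for c' :: complex and s
  proof -
    show "c' = c"
    proof (rule ccontr)
      assume "c' \<noteq> c"
      define D where "D = norm (c - c')"
      have D: "D > 0" using \<open>c' \<noteq> c\<close> by (simp add: D_def)
      have *: "\<bar>D + t\<bar> = s" if "\<bar>t\<bar> = r" for t
      proof -
        have "c + (t / D) *\<^sub>R (c - c') \<in> sphere c r"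
          using D that by (simp add: dist_norm D_def)
        then have "c + (t / D) *\<^sub>R (c - c') \<in> sphere c' s"
          using \<open>sphere c r = sphere c' s\<close> by simp
        then have "s = norm (c + (t / D) *\<^sub>R (c - c') - c')"
          by (simp add: dist_norm norm_minus_commute)
        also have "c + (t / D) *\<^sub>R (c - c') - c' = (1 + t / D) *\<^sub>R (c - c')"
          by (simp add: algebra_simps)
        also have "norm \<dots> = \<bar>(1 + t / D) * D\<bar>" by (simp add: D_def abs_mult)
        also have "(1 + t / D) * D = D + t" using D by (simp add: field_simps)
        finally show ?thesis by simp
      qed
      show False using *[of r] *[of "- r"] D assms by (auto simp: abs_if split: if_splits)
    qed
  qed
  then show ?thesis unfolding circle_center_def using assms by blast
qed

lemma inversion_involution:
  assumes "l > 0" "z \<noteq> Q"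
  shows "inversion Q l (inversion Q l z) = z"
  using assms by (simp add: inversion_def dist_norm power2_eq_square)

lemma inversion_mem_sphere:
  assumes "l > 0" "z \<in> sphere c r" "Q \<notin> sphere c r"
  defines "d \<equiv> (dist c Q)\<^sup>2 - r\<^sup>2"
  shows "inversion Q l z \<in> sphere (Q + (l\<^sup>2 / d) *\<^sub>R (c - Q)) (l\<^sup>2 * r / \<bar>d\<bar>)"
proof -
  define u a where "u = z - Q" and "a = c - Q"
  have "r \<ge> 0" using assms(2) by auto
  have d0: "d \<noteq> 0" unfolding d_def using assms(3) \<open>r \<ge> 0\<close> by auto
  have u0: "u \<noteq> 0" using assms(2,3) u_def by auto
  have d: "d = a \<bullet> a - r\<^sup>2" unfolding d_def a_def dist_norm power2_norm_eq_inner ..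
  have "(dist c z)\<^sup>2 = r\<^sup>2" using assms(2) by auto
  then have "(a - u) \<bullet> (a - u) = r\<^sup>2"
    unfolding dist_norm power2_norm_eq_inner a_def u_def by (simp add: algebra_simps)
  then have ua: "2 * (u \<bullet> a) = u \<bullet> u + d"
    using d by (simp add: inner_diff inner_commute)
  have uu: "u \<bullet> u \<noteq> 0" using u0 by simp
  define k m where "k = l\<^sup>2 / d" and "m = l\<^sup>2 / (u \<bullet> u)"
  have k: "k * d = l\<^sup>2" and m: "m * (u \<bullet> u) = l\<^sup>2" using d0 uu by (auto simp: k_def m_def)
  have "(dist (Q + k *\<^sub>R a) (inversion Q l z))\<^sup>2 = (k *\<^sub>R a - m *\<^sub>R u) \<bullet> (k *\<^sub>R a - m *\<^sub>R u)"
    unfolding inversion_def dist_norm power2_norm_eq_inner m_def u_def by simp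
  also have "\<dots> = k\<^sup>2 * (a \<bullet> a) - k * m * (2 * (u \<bullet> a)) + m\<^sup>2 * (u \<bullet> u)"
    by (simp add: inner_diff inner_commute power2_eq_square algebra_simps)
  also have "\<dots> = k\<^sup>2 * (d + r\<^sup>2) - k * (m * (u \<bullet> u)) - m * (k * d) + m * (m * (u \<bullet> u))"
    unfolding ua using d by (simp add: power2_eq_square algebra_simps)
  also have "\<dots> = k * (k * d) + k\<^sup>2 * r\<^sup>2 - k * l\<^sup>2"
  proof -
    have "k\<^sup>2 * (d + r\<^sup>2) = k * (k * d) + k\<^sup>2 * r\<^sup>2"
      by (simp add: power2_eq_square algebra_simps)
    then show ?thesis unfolding m k by simp
  qed
  also have "\<dots> = (k * r)\<^sup>2" unfolding k by (simp add: power_mult_distrib)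
  also have "\<dots> = (l\<^sup>2 * r / \<bar>d\<bar>)\<^sup>2" by (simp add: k_def power_divide power_mult_distrib)
  finally have "dist (Q + k *\<^sub>R a) (inversion Q l z) = l\<^sup>2 * r / \<bar>d\<bar>"
    using \<open>r \<ge> 0\<close> by (simp add: power2_eq_iff_nonneg)
  then show ?thesis by (simp add: k_def a_def)
qed

lemma inversion_sphere:
  assumes "l > 0" "r > 0" "Q \<notin> sphere c r"
  defines "d \<equiv> (dist c Q)\<^sup>2 - r\<^sup>2"
  shows "inversion Q l ` sphere c r = sphere (Q + (l\<^sup>2 / d) *\<^sub>R (c - Q)) (l\<^sup>2 * r / \<bar>d\<bar>)"
    (is "_ = sphere ?c ?r")
proof (intro equalityI subsetI)
  fix w assume "w \<in> inversion Q l ` sphere c r"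
  then show "w \<in> sphere ?c ?r" using inversion_mem_sphere assms by blast
next
  fix w assume w: "w \<in> sphere ?c ?r"
  have d0: "d \<noteq> 0" unfolding d_def using assms(2,3) by (auto simp: power2_eq_iff_nonneg)
  have d': "(dist ?c Q)\<^sup>2 - ?r\<^sup>2 = l^4 / d"
  proof -
    have "(dist ?c Q)\<^sup>2 - ?r\<^sup>2 = (l\<^sup>2 / d)\<^sup>2 * (dist c Q)\<^sup>2 - (l\<^sup>2 / d)\<^sup>2 * r\<^sup>2"
      by (simp add: dist_norm power_mult_distrib power_divide)
    also have "\<dots> = (l\<^sup>2 / d)\<^sup>2 * d" by (simp add: d_def algebra_simps)
    finally show ?thesis using d0 by (simp add: power2_eq_square power4_eq_xxxx)
  qed
  have Q': "Q \<notin> sphere ?c ?r"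
  proof
    assume "Q \<in> sphere ?c ?r"
    then have "(dist ?c Q)\<^sup>2 - ?r\<^sup>2 = 0" by (metis diff_self mem_sphere)
    then show False using d' d0 assms(1) by simp
  qed
  have s: "Q + (l\<^sup>2 / (l^4 / d)) *\<^sub>R (?c - Q) = c"
    using d0 assms(1) by (simp add: power2_eq_square power4_eq_xxxx)
  have t: "l\<^sup>2 * ?r / \<bar>l^4 / d\<bar> = r"
    using d0 assms(1) by (simp add: power2_eq_square power4_eq_xxxx abs_mult)
  have "inversion Q l w \<in> sphere c r"
    using inversion_mem_sphere[OF assms(1) w Q'] unfolding d' s t .
  moreover have "w = inversion Q l (inversion Q l w)"
    using inversion_involution[OF assms(1)] w Q' by metis
  ultimately show "w \<in> inversion Q l ` sphere c r" by blast
qed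

lemma steiner_chain_circles:
  assumes "N \<ge> 3" "R > 0" "l > 0" "admissible N R Q \<phi>" "S \<in> set (steiner_chain N R Q l \<phi>)"
  shows "is_circle S"
proof -
  obtain i where i: "i \<in> {1..N}" "S = inversion Q l ` ring_circle N R \<phi> i"
    using assms(5) unfolding steiner_chain_def set_map set_upt atLeastLessThanSuc_atLeastAtMost
    by blast
  have "sin (pi / real N) > 0"
    using assms(1) by (intro sin_gt_zero) (auto simp: field_simps)
  then have r: "R * sin (pi / real N) > 0" using assms(2) by simp
  define c where "c = rcis R (\<phi> + 2 * pi * real i / real N)"
  define r where "r = R * sin (pi / real N)"
  have "r > 0" using r r_def by simp
  have Q: "Q \<notin> sphere c r"
    using assms(4) i(1) unfolding admissible_def ring_circle_def c_def r_def by blast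
  then have "(dist c Q)\<^sup>2 - r\<^sup>2 \<noteq> 0"
    using \<open>r > 0\<close> by (auto simp: power2_eq_iff_nonneg)
  then have "l\<^sup>2 * r / \<bar>(dist c Q)\<^sup>2 - r\<^sup>2\<bar> > 0" using \<open>r > 0\<close> assms(3) by simp
  then show ?thesis
    using i(2) inversion_sphere[OF assms(3) \<open>r > 0\<close> Q]
    unfolding is_circle_def ring_circle_def c_def[symmetric] r_def[symmetric] by blast
qed

end

theory Submission
  imports Defs
begin

text \<open>Write \<open>k = R cos (\<pi>/N)\<close> for the radius of \<^term>\<open>C_reg N R\<close>. A circle of the ring has
  its center \<open>c\<close> on the circle \<open>|c| = R\<close> and is orthogonal to \<^term>\<open>C_reg N R\<close>, so the power
  of \<open>Q\<close> with respect to it, \<open>k\<^sup>2 + |Q|\<^sup>2 - 2 c \<bullet> Q\<close>, is affine in \<open>c\<close>. Since inversion sends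
  the circle to one with center \<open>Q + (l\<^sup>2 / power) (c - Q)\<close>, the map taking old centers to new
  ones is projective. Its determinant is a nonzero multiple of \<open>k\<^sup>2 - |Q|\<^sup>2\<close>, so off
  \<^term>\<open>C_reg N R\<close> it is injective and carries the circle \<open>|c| = R\<close> into a fixed nondegenerate
  conic, which contains all vertices (\<open>inverted_center_in_conic\<close>, \<open>is_conic_vertex_conic\<close>).

  For the sides, consecutive circles of the ring touch at a point \<open>p\<close> of \<^term>\<open>C_reg N R\<close>
  and are orthogonal to that circle there. Inversion preserves tangency and orthogonality:
  the two image circles touch at the image \<open>t\<close> of \<open>p\<close>, so \<open>t\<close> lies on their line of centers,
  and that line is perpendicular at \<open>t\<close> to the radius of the image of \<^term>\<open>C_reg N R\<close>
  (\<open>contact_point_on_side\<close>, \<open>side_perpendicular_to_radius\<close>).\<close>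

section \<open>Tangents and conics\<close>

lemma tangent_line_perpendicular:
  fixes w w' t o' :: complex
  assumes "w \<noteq> w'" "t \<in> affine hull {w, w'}" "t \<in> sphere o' \<rho>" "\<rho> > 0"
    and "(w - t) \<bullet> (o' - t) = 0" "(w' - t) \<bullet> (o' - t) = 0"
  shows "tangent_line (affine hull {w, w'}) (sphere o' \<rho>)"
proof -
  have "z = t" if z: "z \<in> affine hull {w, w'}" "z \<in> sphere o' \<rho>" for z
  proof -
    obtain u v where uv: "u + v = 1" "z = u *\<^sub>R w + v *\<^sub>R w'"
      using z(1) unfolding affine_hull_2 by blast
    have "z - t = u *\<^sub>R (w - t) + v *\<^sub>R (w' - t)"
      using uv(1) unfolding uv(2)
      by (simp add: algebra_simps flip: scaleR_add_left)
    then have orth: "(z - t) \<bullet> (o' - t) = 0"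
      using assms(5,6) by (simp add: inner_add_left)
    have "(dist o' z)\<^sup>2 = (o' - t - (z - t)) \<bullet> (o' - t - (z - t))"
      by (simp add: dist_norm power2_norm_eq_inner)
    also have "\<dots> = (o' - t) \<bullet> (o' - t) + (z - t) \<bullet> (z - t)"
      unfolding inner_diff_left[of "o' - t"] inner_diff_right[of _ "o' - t"]
      using orth by (simp add: inner_commute)
    also have "(o' - t) \<bullet> (o' - t) = (dist o' t)\<^sup>2"
      by (simp add: dist_norm power2_norm_eq_inner)
    finally show "z = t" using z(2) assms(3) by simp
  qed
  then have "\<exists>!p. p \<in> affine hull {w, w'} \<inter> sphere o' \<rho>" using assms(2,3) by blast
  moreover have "is_line (affine hull {w, w'})"
    using assms(1) by (simp add: is_line_def aff_dim_2)
  ultimately show ?thesis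
    using assms(4) unfolding tangent_line_def is_circle_def by blast
qed

text \<open>The pullback of the form \<open>diag (1, 1, - R\<^sup>2)\<close> along the matrix of the three linear forms
  has determinant \<open>- R\<^sup>2\<close> times the square of the determinant of that matrix.\<close>

lemma is_conic_linear_forms:
  fixes a1 b1 c1 a2 b2 c2 a3 b3 c3 R :: real
  defines "E \<equiv> {z. (a1 * Re z + b1 * Im z + c1)\<^sup>2 + (a2 * Re z + b2 * Im z + c2)\<^sup>2
                  = R\<^sup>2 * (a3 * Re z + b3 * Im z + c3)\<^sup>2}"
  assumes "E \<noteq> {}" "R \<noteq> 0"
    and det: "a1 * (b2 * c3 - b3 * c2) - b1 * (a2 * c3 - a3 * c2) + c1 * (a2 * b3 - a3 * b2) \<noteq> 0"
  shows "is_conic E"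
proof -
  define a b c d e f where
    "a = a1 * a1 + a2 * a2 - R\<^sup>2 * (a3 * a3)" and
    "b = a1 * b1 + a2 * b2 - R\<^sup>2 * (a3 * b3)" and
    "c = b1 * b1 + b2 * b2 - R\<^sup>2 * (b3 * b3)" and
    "d = a1 * c1 + a2 * c2 - R\<^sup>2 * (a3 * c3)" and
    "e = b1 * c1 + b2 * c2 - R\<^sup>2 * (b3 * c3)" and
    "f = c1 * c1 + c2 * c2 - R\<^sup>2 * (c3 * c3)"
  note defs = a_def b_def c_def d_def e_def f_def
  have form: "a * x\<^sup>2 + 2 * b * x * y + c * y\<^sup>2 + 2 * d * x + 2 * e * y + f
      = (a1 * x + b1 * y + c1)\<^sup>2 + (a2 * x + b2 * y + c2)\<^sup>2 - R\<^sup>2 * (a3 * x + b3 * y + c3)\<^sup>2" for x y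
    unfolding defs by algebra
  have "det (vector [vector [a, b, d], vector [b, c, e], vector [d, e, f]] :: real ^ 3 ^ 3)
      = a * c * f + b * e * d + d * b * e - a * e * e - b * b * f - d * c * d"
    by (simp add: det_3)
  also have "\<dots> = - R\<^sup>2 *
      (a1 * (b2 * c3 - b3 * c2) - b1 * (a2 * c3 - a3 * c2) + c1 * (a2 * b3 - a3 * b2))\<^sup>2"
    unfolding defs by algebra
  finally have "det (vector [vector [a, b, d], vector [b, c, e], vector [d, e, f]] :: real ^ 3 ^ 3) \<noteq> 0"
    using det \<open>R \<noteq> 0\<close> by simp
  moreover have "E = {z. a * (Re z)\<^sup>2 + 2 * b * Re z * Im z + c * (Im z)\<^sup>2
             + 2 * d * Re z + 2 * e * Im z + f = 0}"
    unfolding E_def form by simp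
  ultimately show ?thesis using \<open>E \<noteq> {}\<close> unfolding is_conic_def by blast
qed

section \<open>Centers of inverted circles\<close>

text \<open>The power of \<open>Q\<close> with respect to the circle with center \<open>c\<close> that is orthogonal to the
  circle of radius \<open>k\<close> about the origin.\<close>

definition orth_power :: "real \<Rightarrow> complex \<Rightarrow> complex \<Rightarrow> real" where
  "orth_power k Q c = k\<^sup>2 + Q \<bullet> Q - 2 * (c \<bullet> Q)"

definition inverted_center :: "real \<Rightarrow> complex \<Rightarrow> real \<Rightarrow> complex \<Rightarrow> complex" where
  "inverted_center k Q l c = Q + (l\<^sup>2 / orth_power k Q c) *\<^sub>R (c - Q)"

lemma power_eq_orth_power:
  assumes "c \<bullet> c = r\<^sup>2 + k\<^sup>2"
  shows "(dist c Q)\<^sup>2 - r\<^sup>2 = orth_power k Q c"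
proof -
  have "(dist c Q)\<^sup>2 = c \<bullet> c + Q \<bullet> Q - 2 * (c \<bullet> Q)"
    by (simp add: dist_norm power2_norm_eq_inner inner_diff inner_commute)
  then show ?thesis using assms by (simp add: orth_power_def)
qed

lemma orth_power_nonzero:
  assumes "c \<bullet> c = r\<^sup>2 + k\<^sup>2" "r > 0" "Q \<notin> sphere c r"
  shows "orth_power k Q c \<noteq> 0"
  using assms power_eq_orth_power[OF assms(1), of Q] by (auto simp: power2_eq_iff_nonneg)

lemma circle_center_inversion:
  assumes "c \<bullet> c = r\<^sup>2 + k\<^sup>2" "r > 0" "l > 0" "Q \<notin> sphere c r"
  shows "circle_center (inversion Q l ` sphere c r) = inverted_center k Q l c"
proof -
  have "l\<^sup>2 * r / \<bar>orth_power k Q c\<bar> > 0"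
    using orth_power_nonzero[OF assms(1,2,4)] assms(2,3) by simp
  then show ?thesis
    unfolding inversion_sphere[OF assms(3,2,4)] power_eq_orth_power[OF assms(1)]
    by (simp add: circle_center_sphere inverted_center_def)
qed

text \<open>Equal images make \<open>c - Q\<close> and \<open>c' - Q\<close> proportional with the ratio \<open>s\<close> of the powers.
  As \<^term>\<open>orth_power k Q c\<close> is linear in \<open>c - Q\<close> up to the constant \<open>k\<^sup>2 - Q \<bullet> Q\<close>, which does
  not vanish, \<open>s = 1\<close>.\<close>

lemma inverted_center_inj:
  assumes "l > 0" "Q \<bullet> Q \<noteq> k\<^sup>2" "orth_power k Q c \<noteq> 0" "orth_power k Q c' \<noteq> 0"
    and eq: "inverted_center k Q l c = inverted_center k Q l c'"
  shows "c = c'"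
proof -
  define s where "s = orth_power k Q c / orth_power k Q c'"
  have "(l\<^sup>2 / orth_power k Q c) *\<^sub>R (c - Q) = (l\<^sup>2 / orth_power k Q c') *\<^sub>R (c' - Q)"
    using eq by (simp add: inverted_center_def)
  then have "(orth_power k Q c / l\<^sup>2) *\<^sub>R (l\<^sup>2 / orth_power k Q c) *\<^sub>R (c - Q)
      = (orth_power k Q c / l\<^sup>2) *\<^sub>R (l\<^sup>2 / orth_power k Q c') *\<^sub>R (c' - Q)"
    by (rule arg_cong)
  then have c: "c - Q = s *\<^sub>R (c' - Q)"
    using assms(1,3,4) by (simp add: s_def)
  have linear: "orth_power k Q x = k\<^sup>2 - Q \<bullet> Q - 2 * ((x - Q) \<bullet> Q)" for x
    by (simp add: orth_power_def inner_diff_left)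
  have "orth_power k Q c = s * orth_power k Q c'"
    using assms(4) by (simp add: s_def)
  then have "(1 - s) * (k\<^sup>2 - Q \<bullet> Q) = 0"
    unfolding linear[of c] linear[of c'] c by (simp add: algebra_simps)
  then have "s = 1" using assms(2) by simp
  then show ?thesis using c by simp
qed

section \<open>The conic through the vertices\<close>

text \<open>The inverse of the projective map \<^term>\<open>inverted_center k Q l\<close> sends \<open>w\<close> to
  \<open>(m Q - D (w - Q)) / m\<close>, where \<open>D = Q \<bullet> Q - k\<^sup>2\<close> and \<open>m = l\<^sup>2 + 2 (w - Q) \<bullet> Q\<close>. The equation
  says that this point has absolute value \<open>R\<close>, with the denominator cleared.\<close>

definition vertex_conic :: "real \<Rightarrow> real \<Rightarrow> complex \<Rightarrow> real \<Rightarrow> complex set" where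
  "vertex_conic R k Q l =
    {w. (norm ((l\<^sup>2 + 2 * ((w - Q) \<bullet> Q)) *\<^sub>R Q - (Q \<bullet> Q - k\<^sup>2) *\<^sub>R (w - Q)))\<^sup>2
        = R\<^sup>2 * (l\<^sup>2 + 2 * ((w - Q) \<bullet> Q))\<^sup>2}"

lemma inverted_center_in_conic:
  assumes "norm c = R" "orth_power k Q c \<noteq> 0"
  shows "inverted_center k Q l c \<in> vertex_conic R k Q l"
proof -
  define h where "h = l\<^sup>2 / orth_power k Q c"
  define D where "D = Q \<bullet> Q - k\<^sup>2"
  have w: "inverted_center k Q l c - Q = h *\<^sub>R (c - Q)"
    by (simp add: inverted_center_def h_def)
  have "l\<^sup>2 = h * orth_power k Q c" using assms(2) by (simp add: h_def)
  then have m: "l\<^sup>2 + 2 * ((h *\<^sub>R (c - Q)) \<bullet> Q) = - (h * D)"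
    by (simp add: orth_power_def D_def inner_diff_left algebra_simps)
  have "(- (h * D)) *\<^sub>R Q - D *\<^sub>R (h *\<^sub>R (c - Q)) = (- (h * D)) *\<^sub>R c"
    by (simp add: algebra_simps)
  then show ?thesis
    using assms(1) unfolding vertex_conic_def mem_Collect_eq w m
    by (simp add: D_def[symmetric] power_mult_distrib)
qed

lemma vertex_conic_nonempty:
  assumes "R > 0" "k > 0"
  shows "vertex_conic R k Q l \<noteq> {}"
proof -
  \<comment> \<open>The powers at the antipodal points \<open>R\<close> and \<open>- R\<close> have a positive sum.\<close>
  have "orth_power k Q (of_real R) + orth_power k Q (- of_real R) = 2 * (k\<^sup>2 + Q \<bullet> Q)"
    by (simp add: orth_power_def)
  moreover have "2 * (k\<^sup>2 + Q \<bullet> Q) > 0"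
    using assms(2) by (simp add: add_pos_nonneg)
  ultimately have "orth_power k Q (of_real R) \<noteq> 0 \<or> orth_power k Q (- of_real R) \<noteq> 0"
    by auto
  moreover have "norm (of_real R :: complex) = R" "norm (- of_real R :: complex) = R"
    using assms(1) by simp_all
  ultimately show ?thesis using inverted_center_in_conic by blast
qed

text \<open>In coordinates the three linear forms have determinant \<open>l\<^sup>2 (Q \<bullet> Q - k\<^sup>2)\<^sup>2\<close>.\<close>

lemma is_conic_vertex_conic:
  assumes "R > 0" "k > 0" "l > 0" "Q \<bullet> Q \<noteq> k\<^sup>2"
  shows "is_conic (vertex_conic R k Q l)"
proof -
  define A B where "A = Re Q" and "B = Im Q"
  define D where "D = A\<^sup>2 + B\<^sup>2 - k\<^sup>2"
  define m where "m = l\<^sup>2 - 2 * (A\<^sup>2 + B\<^sup>2)"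
  have QQ: "Q \<bullet> Q = A\<^sup>2 + B\<^sup>2"
    by (simp add: inner_complex_def A_def B_def power2_eq_square)
  have D: "D \<noteq> 0" using assms(4) unfolding QQ D_def by simp
  have E: "vertex_conic R k Q l =
      {z. ((2 * A\<^sup>2 - D) * Re z + (2 * A * B) * Im z + A * (m + D))\<^sup>2
        + ((2 * A * B) * Re z + (2 * B\<^sup>2 - D) * Im z + B * (m + D))\<^sup>2
        = R\<^sup>2 * ((2 * A) * Re z + (2 * B) * Im z + m)\<^sup>2}"
  proof -
    have m': "l\<^sup>2 + 2 * ((w - Q) \<bullet> Q) = (2 * A) * Re w + (2 * B) * Im w + m" for w
      unfolding inner_complex_def minus_complex.sel A_def[symmetric] B_def[symmetric] m_def
      by algebra
    have "(norm (((2 * A) * Re w + (2 * B) * Im w + m) *\<^sub>R Q - D *\<^sub>R (w - Q)))\<^sup>2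
      = ((2 * A\<^sup>2 - D) * Re w + (2 * A * B) * Im w + A * (m + D))\<^sup>2
        + ((2 * A * B) * Re w + (2 * B\<^sup>2 - D) * Im w + B * (m + D))\<^sup>2" for w
      unfolding cmod_power2 minus_complex.sel scaleR_complex.sel A_def[symmetric] B_def[symmetric]
      by algebra
    then show ?thesis unfolding vertex_conic_def m' QQ D_def[symmetric] by simp
  qed
  have "(2 * A\<^sup>2 - D) * ((2 * B\<^sup>2 - D) * m - (2 * B) * (B * (m + D)))
      - (2 * A * B) * ((2 * A * B) * m - (2 * A) * (B * (m + D)))
      + A * (m + D) * ((2 * A * B) * (2 * B) - (2 * A) * (2 * B\<^sup>2 - D)) = D\<^sup>2 * l\<^sup>2"
    unfolding m_def by algebra
  also have "\<dots> \<noteq> 0" using D assms(3) by simp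
  finally have det: "(2 * A\<^sup>2 - D) * ((2 * B\<^sup>2 - D) * m - (2 * B) * (B * (m + D)))
      - (2 * A * B) * ((2 * A * B) * m - (2 * A) * (B * (m + D)))
      + A * (m + D) * ((2 * A * B) * (2 * B) - (2 * A) * (2 * B\<^sup>2 - D)) \<noteq> 0" .
  show ?thesis
    unfolding E
  proof (rule is_conic_linear_forms)
    show "{z. ((2 * A\<^sup>2 - D) * Re z + (2 * A * B) * Im z + A * (m + D))\<^sup>2
        + ((2 * A * B) * Re z + (2 * B\<^sup>2 - D) * Im z + B * (m + D))\<^sup>2
        = R\<^sup>2 * ((2 * A) * Re z + (2 * B) * Im z + m)\<^sup>2} \<noteq> {}"
      using vertex_conic_nonempty[OF assms(1,2), of Q l] unfolding E .
  qed (use assms(1) det in simp_all)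
qed

section \<open>The circle touching the sides\<close>

text \<open>The affine combination has the two powers as its weights, up to normalization: they
  cancel the denominators of the two new centers, and their sum is twice the squared distance
  of \<open>Q\<close> from the midpoint \<open>p\<close>.\<close>

lemma contact_point_on_side:
  assumes "norm p = k" "p \<noteq> Q" "c + c' = 2 *\<^sub>R p"
    and "orth_power k Q c \<noteq> 0" "orth_power k Q c' \<noteq> 0"
  shows "inversion Q l p \<in> affine hull {inverted_center k Q l c, inverted_center k Q l c'}"
proof -
  define d d' U where "d = orth_power k Q c" and "d' = orth_power k Q c'" and "U = (dist p Q)\<^sup>2"
  have nz: "d \<noteq> 0" "d' \<noteq> 0" "U \<noteq> 0" using assms(2,4,5) by (auto simp: d_def d'_def U_def)
  have pp: "p \<bullet> p = k\<^sup>2" using assms(1) by (simp flip: power2_norm_eq_inner)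
  have "U = k\<^sup>2 + Q \<bullet> Q - 2 * (p \<bullet> Q)"
    by (simp add: U_def dist_norm power2_norm_eq_inner inner_diff inner_commute pp)
  moreover have "c \<bullet> Q + c' \<bullet> Q = 2 * (p \<bullet> Q)"
    using arg_cong[OF assms(3), of "\<lambda>x. x \<bullet> Q"] by (simp add: inner_add_left)
  ultimately have dd: "d + d' = 2 * U"
    by (simp add: d_def d'_def orth_power_def)
  define u v where "u = d / (2 * U)" and "v = d' / (2 * U)"
  have uv: "u + v = 1" using dd nz by (simp add: u_def v_def flip: add_divide_distrib)
  have "u *\<^sub>R inverted_center k Q l c + v *\<^sub>R inverted_center k Q l c'
      = (u + v) *\<^sub>R Q + (u * (l\<^sup>2 / d)) *\<^sub>R (c - Q) + (v * (l\<^sup>2 / d')) *\<^sub>R (c' - Q)"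
    by (simp add: inverted_center_def d_def d'_def algebra_simps)
  also have "\<dots> = Q + (l\<^sup>2 / (2 * U)) *\<^sub>R (c + c' - 2 *\<^sub>R Q)"
    using nz uv by (simp add: u_def v_def algebra_simps scaleR_2)
  also have "\<dots> = inversion Q l p"
    unfolding assms(3) inversion_def U_def[symmetric]
    by (simp flip: scaleR_diff_right)
  finally show ?thesis using uv unfolding affine_hull_2 mem_Collect_eq by metis
qed

text \<open>The hypothesis \<open>c \<bullet> p = k\<^sup>2\<close> puts \<open>c\<close> on the tangent at \<open>p\<close> of the circle of radius \<open>k\<close>
  about the origin; the circle about \<open>c\<close> through \<open>p\<close> is then orthogonal to it. Orthogonality
  survives inversion, and the conclusion expresses it for the images: \<open>o'\<close> is the center of
  the image of the circle of radius \<open>k\<close>.\<close>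

lemma side_perpendicular_to_radius:
  fixes l :: real
  assumes "norm p = k" "p \<noteq> Q" "c \<bullet> p = k\<^sup>2" "Q \<bullet> Q \<noteq> k\<^sup>2" "orth_power k Q c \<noteq> 0"
  defines "t \<equiv> inversion Q l p"
    and "o' \<equiv> Q + (l\<^sup>2 / (Q \<bullet> Q - k\<^sup>2)) *\<^sub>R (0 - Q)"
  shows "(inverted_center k Q l c - t) \<bullet> (o' - t) = 0"
proof -
  define d D U where "d = orth_power k Q c" and "D = Q \<bullet> Q - k\<^sup>2" and "U = (dist p Q)\<^sup>2"
  have nz: "d \<noteq> 0" "D \<noteq> 0" "U \<noteq> 0" using assms(2,4,5) by (auto simp: d_def D_def U_def)
  have pp: "p \<bullet> p = k\<^sup>2" using assms(1) by (simp flip: power2_norm_eq_inner)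
  define g h q where "g = c \<bullet> Q" and "h = p \<bullet> Q" and "q = Q \<bullet> Q"
  have d: "d = k\<^sup>2 + q - 2 * g" and D: "D = q - k\<^sup>2"
    by (simp_all add: d_def D_def orth_power_def g_def q_def)
  have U: "U = k\<^sup>2 + q - 2 * h"
    by (simp add: U_def dist_norm power2_norm_eq_inner inner_diff inner_commute pp h_def q_def)
  have i1: "(c - Q) \<bullet> Q = g - q" and i2: "(p - Q) \<bullet> Q = h - q"
    and i3: "(c - Q) \<bullet> (p - Q) = k\<^sup>2 - g - h + q" and i4: "(p - Q) \<bullet> (p - Q) = U"
    using assms(3) by (simp_all add: inner_diff inner_commute g_def h_def q_def pp U)
  have "inverted_center k Q l c - t = l\<^sup>2 *\<^sub>R ((1 / d) *\<^sub>R (c - Q) - (1 / U) *\<^sub>R (p - Q))"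
    by (simp add: inverted_center_def t_def inversion_def d_def U_def scaleR_diff_right)
  moreover have "o' - t = (- (l\<^sup>2)) *\<^sub>R ((1 / D) *\<^sub>R Q + (1 / U) *\<^sub>R (p - Q))"
    by (simp add: o'_def t_def inversion_def D_def U_def scaleR_add_right)
  moreover have "((1 / d) *\<^sub>R (c - Q) - (1 / U) *\<^sub>R (p - Q)) \<bullet> ((1 / D) *\<^sub>R Q + (1 / U) *\<^sub>R (p - Q)) = 0"
  proof -
    have "((1 / d) *\<^sub>R (c - Q) - (1 / U) *\<^sub>R (p - Q)) \<bullet> ((1 / D) *\<^sub>R Q + (1 / U) *\<^sub>R (p - Q))
      = (1 / d) * (1 / D) * (g - q) + (1 / d) * (1 / U) * (k\<^sup>2 - g - h + q)
        - (1 / U) * (1 / D) * (h - q) - (1 / U) * (1 / U) * U"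
      unfolding inner_diff_left[of "(1 / d) *\<^sub>R (c - Q)"] inner_add_right
        inner_scaleR_left inner_scaleR_right i1 i2 i3 i4 by (simp add: algebra_simps)
    also have "\<dots> = (U * (g - q) + D * (k\<^sup>2 - g - h + q) - d * (h - q) - d * D) / (d * D * U)"
      using nz by (simp add: field_simps)
    also have "U * (g - q) + D * (k\<^sup>2 - g - h + q) - d * (h - q) - d * D = 0"
      unfolding d D U by algebra
    finally show ?thesis by simp
  qed
  ultimately show ?thesis by simp
qed

section \<open>The Steiner-Soddy polygon\<close>

lemma ring_radius_pos:
  assumes "N \<ge> 3" "R > 0"
  shows "R * sin (pi / real N) > 0" "R * cos (pi / real N) > 0"
proof -
  have a: "0 < pi / real N" "pi / real N < pi / 2" "pi / real N < pi"
    using assms(1) by (auto simp: field_simps)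
  show "R * sin (pi / real N) > 0" using sin_gt_zero[OF a(1,3)] assms(2) by simp
  show "R * cos (pi / real N) > 0" using cos_gt_zero[OF a(1,2)] assms(2) by simp
qed

lemma inner_rcis: "rcis r x \<bullet> rcis s y = r * s * cos (x - y)"
  by (simp add: rcis_def inner_complex_def cos_diff algebra_simps)

lemma ring_center_square:
  "rcis R x \<bullet> rcis R x = (R * sin \<alpha>)\<^sup>2 + (R * cos \<alpha>)\<^sup>2"
  by (simp add: inner_rcis power_mult_distrib flip: distrib_left power2_eq_square)

lemma midpoint_of_chord:
  "rcis R (x - \<alpha>) + rcis R (x + \<alpha>) = 2 *\<^sub>R rcis (R * cos \<alpha>) x"
  by (rule complex_eqI) (simp_all add: rcis_def cos_diff cos_add sin_diff sin_add algebra_simps)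

lemma chord_nondegenerate:
  assumes "R * sin \<alpha> \<noteq> 0"
  shows "rcis R (x - \<alpha>) \<noteq> rcis R (x + \<alpha>)"
proof
  assume eq: "rcis R (x - \<alpha>) = rcis R (x + \<alpha>)"
  have "R * sin \<alpha> * cos x = 0" "R * sin \<alpha> * sin x = 0"
    using arg_cong[OF eq, of Re] arg_cong[OF eq, of Im] assms
    by (auto simp: rcis_def cos_diff cos_add sin_diff sin_add algebra_simps)
  then show False using assms sin_zero_abs_cos_one by force
qed

lemma steiner_soddy_polygon_nth:
  assumes "N \<ge> 3" "R > 0" "l > 0" "admissible N R Q \<phi>" "i < N"
  defines "k \<equiv> R * cos (pi / real N)" and "c \<equiv> rcis R (\<phi> + 2 * pi * real (Suc i) / real N)"
  shows "steiner_soddy_polygon N R Q l \<phi> ! i = inverted_center k Q l c"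
    and "orth_power k Q c \<noteq> 0"
proof -
  define r where "r = R * sin (pi / real N)"
  have r: "r > 0" using ring_radius_pos(1)[OF assms(1,2)] by (simp add: r_def)
  have cc: "c \<bullet> c = r\<^sup>2 + k\<^sup>2"
    unfolding c_def r_def k_def by (rule ring_center_square)
  have ring: "ring_circle N R \<phi> (Suc i) = sphere c r"
    by (simp add: ring_circle_def c_def r_def)
  have Q: "Q \<notin> sphere c r"
    using assms(4,5) ring[symmetric] unfolding admissible_def by auto
  show "orth_power k Q c \<noteq> 0" using orth_power_nonzero[OF cc r Q] .
  have "steiner_soddy_polygon N R Q l \<phi> ! i = circle_center (inversion Q l ` ring_circle N R \<phi> (Suc i))"
    using assms(5) by (simp add: steiner_soddy_polygon_def steiner_chain_def del: upt_Suc)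
  also have "\<dots> = inverted_center k Q l c"
    unfolding ring using circle_center_inversion[OF cc r assms(3) Q] .
  finally show "steiner_soddy_polygon N R Q l \<phi> ! i = inverted_center k Q l c" .
qed

lemma ring_center_cyclic:
  assumes "N > 0" "i < N"
  shows "rcis R (\<phi> + 2 * pi * real (Suc (Suc i mod N)) / real N)
       = rcis R (\<phi> + 2 * pi * real (Suc (Suc i)) / real N)"
proof (cases "Suc i < N")
  case False
  then have i: "Suc i = N" using assms(2) by simp
  have "2 * pi * real (Suc (Suc i)) / real N = 2 * pi * real (Suc 0) / real N + 2 * pi"
    unfolding i using assms(1) by (simp add: field_simps)
  moreover have "rcis R (x + 2 * pi) = rcis R x" for x
    by (simp add: rcis_def complex_eq_iff)
  ultimately show ?thesis using i by (simp flip: add.assoc)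
qed simp

lemma length_steiner_soddy_polygon: "length (steiner_soddy_polygon N R Q l \<phi>) = N"
  by (simp add: steiner_soddy_polygon_def steiner_chain_def del: upt_Suc)

lemma steiner_soddy_polygon_inscribed:
  assumes "N \<ge> 3" "R > 0" "l > 0" "admissible N R Q \<phi>"
  shows "inscribed_in (steiner_soddy_polygon N R Q l \<phi>)
           (vertex_conic R (R * cos (pi / real N)) Q l)"
proof -
  have "steiner_soddy_polygon N R Q l \<phi> ! i \<in> vertex_conic R (R * cos (pi / real N)) Q l"
    if "i < N" for i
    using steiner_soddy_polygon_nth[OF assms that] assms(2)
    by (simp add: inverted_center_in_conic)
  then show ?thesis
    unfolding inscribed_in_def set_conv_nth length_steiner_soddy_polygon by blast
qed

lemma steiner_soddy_polygon_circumscribes: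
  assumes "N \<ge> 3" "R > 0" "l > 0" "Q \<notin> C_reg N R" "admissible N R Q \<phi>"
  shows "circumscribes (steiner_soddy_polygon N R Q l \<phi>) (inversion Q l ` C_reg N R)"
  unfolding circumscribes_def length_steiner_soddy_polygon
proof (intro allI impI)
  fix i assume i: "i < N"
  define \<alpha> where "\<alpha> = pi / real N"
  define k where "k = R * cos \<alpha>"
  have k: "k > 0" and r: "R * sin \<alpha> > 0"
    using ring_radius_pos[OF assms(1,2)] by (simp_all add: k_def \<alpha>_def)
  \<comment> \<open>The contact point of the two circles lies halfway between their centers, so its angle
    exceeds the angle of the first center by half a step.\<close>
  define x where "x = \<phi> + 2 * pi * real (Suc i) / real N + \<alpha>"
  define p where "p = rcis k x"
  define c c' where "c = rcis R (x - \<alpha>)" and "c' = rcis R (x + \<alpha>)"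
  define P where "P = steiner_soddy_polygon N R Q l \<phi>"
  have N: "N > 0" using assms(1) by simp
  have j: "Suc i mod N < N" using N by simp
  have "x + \<alpha> = \<phi> + 2 * pi * real (Suc (Suc i)) / real N"
    using N by (simp add: x_def \<alpha>_def field_simps)
  then have c'_alt: "c' = rcis R (\<phi> + 2 * pi * real (Suc (Suc i mod N)) / real N)"
    unfolding c'_def ring_center_cyclic[OF N i] by simp
  have c_alt: "c = rcis R (\<phi> + 2 * pi * real (Suc i) / real N)"
    by (simp add: c_def x_def)
  have w: "P ! i = inverted_center k Q l c" "orth_power k Q c \<noteq> 0"
    using steiner_soddy_polygon_nth[OF assms(1,2,3,5) i]
    unfolding P_def c_alt k_def \<alpha>_def by simp_all
  have w': "P ! (Suc i mod N) = inverted_center k Q l c'" "orth_power k Q c' \<noteq> 0"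
    using steiner_soddy_polygon_nth[OF assms(1,2,3,5) j]
    unfolding P_def c'_alt k_def \<alpha>_def by simp_all
  have reg: "C_reg N R = sphere 0 k" by (simp add: C_reg_def k_def \<alpha>_def)
  have Q: "Q \<notin> sphere 0 k" using assms(4) reg by simp
  have p: "norm p = k" using k by (simp add: p_def)
  then have pQ: "p \<noteq> Q" using Q by auto
  have QQ: "Q \<bullet> Q \<noteq> k\<^sup>2"
    using Q k by (simp add: power2_eq_iff_nonneg flip: power2_norm_eq_inner)
  have mid: "c + c' = 2 *\<^sub>R p"
    unfolding c_def c'_def p_def k_def by (rule midpoint_of_chord)
  have cp: "c \<bullet> p = k\<^sup>2" "c' \<bullet> p = k\<^sup>2"
    by (simp_all add: c_def c'_def p_def inner_rcis k_def power2_eq_square)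
  have "c \<noteq> c'" unfolding c_def c'_def using less_imp_neq[OF r] by (intro chord_nondegenerate) auto
  then have ww': "inverted_center k Q l c \<noteq> inverted_center k Q l c'"
    using inverted_center_inj[OF assms(3) QQ w(2) w'(2)] by blast
  have pow: "(dist 0 Q)\<^sup>2 - k\<^sup>2 = Q \<bullet> Q - k\<^sup>2"
    by (simp add: dist_norm power2_norm_eq_inner)
  have img: "inversion Q l ` C_reg N R =
      sphere (Q + (l\<^sup>2 / (Q \<bullet> Q - k\<^sup>2)) *\<^sub>R (0 - Q)) (l\<^sup>2 * k / \<bar>Q \<bullet> Q - k\<^sup>2\<bar>)"
    unfolding reg inversion_sphere[OF assms(3) k Q] pow ..
  have "inversion Q l p \<in> inversion Q l ` C_reg N R"
    using p reg by simp
  moreover have "l\<^sup>2 * k / \<bar>Q \<bullet> Q - k\<^sup>2\<bar> > 0" using assms(3) k QQ by simp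
  ultimately have "tangent_line (affine hull {inverted_center k Q l c, inverted_center k Q l c'})
      (inversion Q l ` C_reg N R)"
    unfolding img
    by (intro tangent_line_perpendicular[OF ww' contact_point_on_side[OF p pQ mid w(2) w'(2)]]
        side_perpendicular_to_radius p pQ cp QQ w(2) w'(2))
  then show "tangent_line (side_line (steiner_soddy_polygon N R Q l \<phi>) i) (inversion Q l ` C_reg N R)"
    unfolding side_line_def length_steiner_soddy_polygon w(1)[symmetric] w'(1)[symmetric] P_def .
qed

theorem corollary1:
  fixes N :: nat and R l :: real and Q :: complex
  assumes "N \<ge> 3" and "R > 0" and "l > 0" and "Q \<notin> C_reg N R"
  defines "C \<equiv> inversion Q l ` C_reg N R"
  shows "is_circle C \<and>
    (\<exists>E. is_conic E \<and>
      (\<forall>P \<in> steiner_soddy_family N R Q l. inscribed_in P E \<and> circumscribes P C))"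
proof
  define k where "k = R * cos (pi / real N)"
  have k: "k > 0" using ring_radius_pos(2)[OF assms(1,2)] by (simp add: k_def)
  have Q: "Q \<notin> sphere 0 k" using assms(4) by (simp add: C_reg_def k_def)
  have QQ: "Q \<bullet> Q \<noteq> k\<^sup>2"
    using Q k by (simp add: power2_eq_iff_nonneg flip: power2_norm_eq_inner)
  have "l\<^sup>2 * k / \<bar>(dist 0 Q)\<^sup>2 - k\<^sup>2\<bar> > 0"
    using assms(3) k QQ by (simp add: dist_norm power2_norm_eq_inner)
  then show "is_circle C"
    unfolding C_def C_reg_def k_def[symmetric] inversion_sphere[OF assms(3) k Q] is_circle_def
    by blast
  have "is_conic (vertex_conic R k Q l)"
    using is_conic_vertex_conic[OF assms(2) k assms(3) QQ] .
  moreover have "inscribed_in P (vertex_conic R k Q l) \<and> circumscribes P C"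
    if "P \<in> steiner_soddy_family N R Q l" for P
    using that steiner_soddy_polygon_inscribed[OF assms(1-3)]
      steiner_soddy_polygon_circumscribes[OF assms(1-4)]
    unfolding steiner_soddy_family_def C_def k_def by blast
  ultimately show "\<exists>E. is_conic E \<and>
      (\<forall>P \<in> steiner_soddy_family N R Q l. inscribed_in P E \<and> circumscribes P C)" by blast
qed

end
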